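(* Let $G=(V,E)$ be a finite simple graph and let $g,h\in\{0,1,-1\}^E$ be nonzero vectors such that no vertex of $G$ is both an endpoint of an edge in $\mathrm{supp}(g)$ and an endpoint of an edge in $\mathrm{supp}(h)$, and such that one of the following holds: (1) $g$ is a uniform-sign vector, and $h$ is either a mixed-sign circuit of the rank inequality system of $G$ or a uniform-sign vector of the opposite sign to $g$; or (2) $g$ and $h$ are both mixed-sign circuits of the rank inequality system of $G$. Then $z=g+h$ is also a circuit of the rank inequality system of $G$.
   Context: A vector is mixed-sign if it has at least one positive and at least one negative entry; otherwise it is uniform-sign. The rank inequality system of $G$ is $\sum_{e\in E(G[U])}x(e)\le |U|-1$ for all $\emptyset\neq U\subseteq V$, where $G[U]$ is the subgraph induced by $U$; let $B$ be its constraint matrix, so $(Bx)_U=\sum_{e\in E(G[U])}x(e)$. A circuit of the system is a vector $g\in\mathbb{R}^E\setminus\{0\}$ with coprime integer components such that the support of $Bg$ is inclusion-minimal among the supports of $\{Bx : x\in\mathbb{R}^E\setminus\{0\}\}$. *)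

theory Defs
  imports Complex_Main
begin

text \<open>
  A graph is given by its vertex set V and its set E of edges, an edge being the
  two-element set of its endpoints. A vector indexed by a set I is a total function of which
  only the values on I are meaningful: no notion below inspects a value outside I.
\<close>

definition finite_simple_graph :: "'a set \<Rightarrow> 'a set set \<Rightarrow> bool" where
  "finite_simple_graph V E \<longleftrightarrow> finite V \<and> (\<forall>e\<in>E. e \<subseteq> V \<and> card e = 2)"

definition induced_edges :: "'a set set \<Rightarrow> 'a set \<Rightarrow> 'a set set" where
  "induced_edges E U = {e \<in> E. e \<subseteq> U}"

definition vec_supp :: "'i set \<Rightarrow> ('i \<Rightarrow> real) \<Rightarrow> 'i set" where
  "vec_supp I x = {i \<in> I. x i \<noteq> 0}"

definition nonzero_vec :: "'i set \<Rightarrow> ('i \<Rightarrow> real) \<Rightarrow> bool" where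
  "nonzero_vec I x \<longleftrightarrow> (\<exists>i\<in>I. x i \<noteq> 0)"

definition mixed_sign :: "'i set \<Rightarrow> ('i \<Rightarrow> real) \<Rightarrow> bool" where
  "mixed_sign I x \<longleftrightarrow> (\<exists>i\<in>I. x i > 0) \<and> (\<exists>i\<in>I. x i < 0)"

definition uniform_sign :: "'i set \<Rightarrow> ('i \<Rightarrow> real) \<Rightarrow> bool" where
  "uniform_sign I x \<longleftrightarrow> \<not> mixed_sign I x"

text \<open>Intended for nonzero uniform-sign vectors; the zero vector has no sign.\<close>

definition opposite_sign :: "'i set \<Rightarrow> ('i \<Rightarrow> real) \<Rightarrow> ('i \<Rightarrow> real) \<Rightarrow> bool" where
  "opposite_sign I x y \<longleftrightarrow>
     (\<forall>i\<in>I. x i \<ge> 0 \<and> y i \<le> 0) \<or> (\<forall>i\<in>I. x i \<le> 0 \<and> y i \<ge> 0)"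

definition coprime_integer_vec :: "'i set \<Rightarrow> ('i \<Rightarrow> real) \<Rightarrow> bool" where
  "coprime_integer_vec I x \<longleftrightarrow>
     (\<exists>k :: 'i \<Rightarrow> int. (\<forall>i\<in>I. x i = of_int (k i)) \<and> Gcd (k ` I) = 1)"

definition mat_vec :: "'i set \<Rightarrow> ('r \<Rightarrow> 'i \<Rightarrow> real) \<Rightarrow> ('i \<Rightarrow> real) \<Rightarrow> 'r \<Rightarrow> real" where
  "mat_vec I B x r = (\<Sum>i\<in>I. B r i * x i)"

text \<open>
  Circuits of an inequality system with constraint matrix B, whose rows are indexed by R and
  whose columns are indexed by I.
\<close>

definition system_circuit :: "'r set \<Rightarrow> 'i set \<Rightarrow> ('r \<Rightarrow> 'i \<Rightarrow> real) \<Rightarrow> ('i \<Rightarrow> real) \<Rightarrow> bool" where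
  "system_circuit R I B g \<longleftrightarrow>
     nonzero_vec I g \<and> coprime_integer_vec I g \<and>
     \<not> (\<exists>x. nonzero_vec I x \<and> vec_supp R (mat_vec I B x) \<subset> vec_supp R (mat_vec I B g))"

definition rank_rows :: "'a set \<Rightarrow> 'a set set" where
  "rank_rows V = {U. U \<noteq> {} \<and> U \<subseteq> V}"

definition rank_matrix :: "'a set set \<Rightarrow> 'a set \<Rightarrow> 'a set \<Rightarrow> real" where
  "rank_matrix E U e = (if e \<in> induced_edges E U then 1 else 0)"

definition rank_circuit :: "'a set \<Rightarrow> 'a set set \<Rightarrow> ('a set \<Rightarrow> real) \<Rightarrow> bool" where
  "rank_circuit V E g \<longleftrightarrow> system_circuit (rank_rows V) E (rank_matrix E) g"

lemma mat_vec_rank_matrix: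
  assumes "finite_simple_graph V E"
  shows "mat_vec E (rank_matrix E) x U = (\<Sum>e\<in>induced_edges E U. x e)"
proof -
  have "finite V" and "E \<subseteq> Pow V"
    using assms by (auto simp: finite_simple_graph_def)
  then have "finite E"
    by (meson finite_Pow_iff finite_subset)
  then have "(\<Sum>e\<in>induced_edges E U. x e) = (\<Sum>e\<in>E. if e \<subseteq> U then x e else 0)"
    unfolding induced_edges_def by (rule sum.inter_filter)
  also have "\<dots> = mat_vec E (rank_matrix E) x U"
    unfolding mat_vec_def by (intro sum.cong) (auto simp: rank_matrix_def induced_edges_def)
  finally show ?thesis by simp
qed

end

theory Submission
  imports Defs
begin

text \<open>
  Write x(U) for the sum of x over the edges inside U. Provided B g has a nonzero entry, g is
  support-minimal exactly if every x with supp(Bx) contained in supp(Bg) is a scalar multiple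
  of g: otherwise some combination x - c g would have strictly smaller support. The theorem
  therefore asks that every x dominated by z = g + h, in the sense that x(U) = 0 whenever
  z(U) = 0, be a multiple of z.

  Single edges as vertex sets show that x is supported on the union of supp(g) and supp(h). If
  e in supp(g) and f in supp(h) carry opposite values, the vertex set consisting of their four endpoints
  contains no other edge of the two supports, so z vanishes on it and x(e) = - x(f)
  (\<open>opposite_entries_cancel\<close>). If g is uniform-sign, comparing all of its edges with one edge of
  h of the other sign makes x proportional to g on supp(g) (\<open>proportional_if_opposed\<close>). If g is
  a circuit, intersecting vertex sets with the endpoints of supp(g) transfers the domination by
  z to domination of the restriction of x by g, and x is again proportional to g on supp(g)
  (\<open>proportional_if_circuit\<close>). The same applies to h, and one pair of opposite entries forces
  the two factors to agree. Each alternative of the hypothesis provides these ingredients.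
\<close>

section \<open>Circuits and scalar multiples\<close>

lemma mat_vec_diff_scaled:
  "mat_vec I B (\<lambda>i. y i - c * x i) r = mat_vec I B y r - c * mat_vec I B x r"
  unfolding mat_vec_def
  by (simp add: sum_subtractf sum_distrib_left algebra_simps)

lemma mat_vec_scaled:
  assumes "\<forall>i\<in>I. x i = c * g i"
  shows "mat_vec I B x r = c * mat_vec I B g r"
  unfolding mat_vec_def sum_distrib_left using assms by (intro sum.cong) auto

text \<open>
  Eliminating the entry r between y and g leaves a vector of strictly smaller support, which
  must therefore be zero.
\<close>

lemma circuit_dominates_only_multiples:
  assumes circ: "system_circuit R I B g"
    and r: "r \<in> R" "mat_vec I B g r \<noteq> 0"
    and sub: "vec_supp R (mat_vec I B y) \<subseteq> vec_supp R (mat_vec I B g)"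
  shows "\<exists>c. \<forall>i\<in>I. y i = c * g i"
proof -
  define c where "c = mat_vec I B y r / mat_vec I B g r"
  define w where "w = (\<lambda>i. y i - c * g i)"
  have w: "mat_vec I B w s = mat_vec I B y s - c * mat_vec I B g s" for s
    unfolding w_def by (rule mat_vec_diff_scaled)
  have "mat_vec I B w r = 0"
    using r by (simp add: w c_def)
  then have "vec_supp R (mat_vec I B w) \<subset> vec_supp R (mat_vec I B g)"
    using sub r by (fastforce simp: vec_supp_def w)
  then have "\<not> nonzero_vec I w"
    using circ by (auto simp: system_circuit_def)
  then have "\<forall>i\<in>I. y i = c * g i"
    by (simp add: nonzero_vec_def w_def)
  then show ?thesis by blast
qed

lemma system_circuitI:
  assumes "nonzero_vec I g" and "coprime_integer_vec I g"
    and mult: "\<And>x. vec_supp R (mat_vec I B x) \<subseteq> vec_supp R (mat_vec I B g)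
                \<Longrightarrow> \<exists>c. \<forall>i\<in>I. x i = c * g i"
  shows "system_circuit R I B g"
proof -
  have False
    if x: "nonzero_vec I x" and sub: "vec_supp R (mat_vec I B x) \<subset> vec_supp R (mat_vec I B g)"
    for x
  proof -
    obtain c where c: "\<forall>i\<in>I. x i = c * g i"
      using mult sub by blast
    have "c \<noteq> 0"
      using x c by (auto simp: nonzero_vec_def)
    then have "vec_supp R (mat_vec I B x) = vec_supp R (mat_vec I B g)"
      by (simp add: vec_supp_def mat_vec_scaled[OF c])
    then show False using sub by simp
  qed
  then show ?thesis
    using assms(1,2) by (auto simp: system_circuit_def)
qed

lemma coprime_integer_vec_if_sign_entries:
  assumes val: "\<forall>i\<in>I. x i \<in> {0, 1, -1}" and "nonzero_vec I x"
  shows "coprime_integer_vec I x"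
proof -
  define k where "k = (\<lambda>i. \<lfloor>x i\<rfloor>)"
  have k: "\<forall>i\<in>I. x i = of_int (k i)"
    using val by (auto simp: k_def)
  obtain i where i: "i \<in> I" "x i \<noteq> 0"
    using assms(2) by (auto simp: nonzero_vec_def)
  then have "x i = 1 \<or> x i = -1"
    using val by auto
  then have "k i = 1 \<or> k i = -1"
    by (auto simp: k_def floor_eq_iff)
  moreover have "Gcd (k ` I) dvd k i"
    using i by (intro Gcd_dvd) auto
  ultimately have "is_unit (Gcd (k ` I))"
    by auto
  then have "Gcd (k ` I) = 1"
    by simp
  then show ?thesis
    using k by (auto simp: coprime_integer_vec_def)
qed

section \<open>Rank inequalities and induced edges\<close>

lemma induced_edges_empty:
  assumes "finite_simple_graph V E"
  shows "induced_edges E {} = {}"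
  using assms by (fastforce simp: finite_simple_graph_def induced_edges_def)

lemma induced_edges_edge:
  assumes "finite_simple_graph V E" and "e \<in> E"
  shows "induced_edges E e = {e}"
proof -
  have "f = e" if "f \<in> E" "f \<subseteq> e" for f
  proof -
    have "card f = 2" "card e = 2"
      using assms that by (auto simp: finite_simple_graph_def)
    then show ?thesis
      using that by (metis card_subset_eq card.infinite zero_neq_numeral)
  qed
  then show ?thesis
    using assms(2) by (auto simp: induced_edges_def)
qed

lemma finite_induced_edges:
  assumes "finite_simple_graph V E"
  shows "finite (induced_edges E U)"
proof -
  have "finite V" and "induced_edges E U \<subseteq> Pow V"
    using assms by (auto simp: finite_simple_graph_def induced_edges_def)
  then show ?thesis
    by (meson finite_Pow_iff finite_subset)
qed

text \<open>
  The empty vertex set is not a row, but it induces no edge and so imposes no condition.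
\<close>

lemma rank_supp_subset_iff:
  assumes "finite_simple_graph V E"
  shows "vec_supp (rank_rows V) (mat_vec E (rank_matrix E) x)
           \<subseteq> vec_supp (rank_rows V) (mat_vec E (rank_matrix E) y)
         \<longleftrightarrow> (\<forall>U\<subseteq>V. (\<Sum>e\<in>induced_edges E U. y e) = 0 \<longrightarrow> (\<Sum>e\<in>induced_edges E U. x e) = 0)"
proof -
  have "(\<Sum>e\<in>induced_edges E {}. x e) = 0"
    by (simp add: induced_edges_empty[OF assms])
  then have "(\<forall>U\<in>rank_rows V. (\<Sum>e\<in>induced_edges E U. y e) = 0 \<longrightarrow> (\<Sum>e\<in>induced_edges E U. x e) = 0)
    \<longleftrightarrow> (\<forall>U\<subseteq>V. (\<Sum>e\<in>induced_edges E U. y e) = 0 \<longrightarrow> (\<Sum>e\<in>induced_edges E U. x e) = 0)"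
    unfolding rank_rows_def by (metis (mono_tags, lifting) mem_Collect_eq)
  then show ?thesis
    by (auto simp: vec_supp_def mat_vec_rank_matrix[OF assms])
qed

lemma rank_circuit_dominates_only_multiples:
  assumes graph: "finite_simple_graph V E" and circ: "rank_circuit V E g"
    and dom: "\<And>U. U \<subseteq> V \<Longrightarrow> (\<Sum>e\<in>induced_edges E U. g e) = 0
                \<Longrightarrow> (\<Sum>e\<in>induced_edges E U. y e) = 0"
  shows "\<exists>c. \<forall>e\<in>E. y e = c * g e"
proof -
  obtain e where e: "e \<in> E" "g e \<noteq> 0"
    using circ by (auto simp: rank_circuit_def system_circuit_def nonzero_vec_def)
  have row: "e \<in> rank_rows V"
    using graph e induced_edges_empty[OF graph] induced_edges_edge[OF graph e(1)]
    by (auto simp: finite_simple_graph_def rank_rows_def)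
  have nonzero: "mat_vec E (rank_matrix E) g e \<noteq> 0"
    using e by (simp add: mat_vec_rank_matrix[OF graph] induced_edges_edge[OF graph])
  have "vec_supp (rank_rows V) (mat_vec E (rank_matrix E) y)
          \<subseteq> vec_supp (rank_rows V) (mat_vec E (rank_matrix E) g)"
    using dom by (simp add: rank_supp_subset_iff[OF graph])
  then show ?thesis
    by (rule circuit_dominates_only_multiples[OF circ[unfolded rank_circuit_def] row nonzero])
qed

section \<open>Vectors dominated by a vertex-disjoint sum\<close>

locale dominated_by_disjoint_sum =
  fixes V :: "'a set" and E :: "'a set set" and g h x :: "'a set \<Rightarrow> real"
  assumes graph: "finite_simple_graph V E"
    and disjoint: "\<And>e f. \<lbrakk>e \<in> E; f \<in> E; g e \<noteq> 0; h f \<noteq> 0\<rbrakk> \<Longrightarrow> e \<inter> f = {}"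
    and dominated: "\<And>U. \<lbrakk>U \<subseteq> V; (\<Sum>e\<in>induced_edges E U. g e + h e) = 0\<rbrakk>
                      \<Longrightarrow> (\<Sum>e\<in>induced_edges E U. x e) = 0"
begin

lemma swapped: "dominated_by_disjoint_sum V E h g x"
  using graph disjoint dominated
  by unfold_locales (auto simp: add.commute Int_commute)

lemma edge: "e \<in> E \<Longrightarrow> e \<subseteq> V \<and> e \<noteq> {}"
  using graph by (fastforce simp: finite_simple_graph_def)

lemma h_zero: "\<lbrakk>e \<in> E; g e \<noteq> 0\<rbrakk> \<Longrightarrow> h e = 0"
  using disjoint[of e e] edge by auto

lemma x_zero:
  assumes "e \<in> E" "g e = 0" "h e = 0"
  shows "x e = 0"
  using dominated[of e] assms edge by (simp add: induced_edges_edge[OF graph])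

text \<open>
  A summand can be isolated by shrinking U to the vertices touched by supp(g): this keeps every
  edge of supp(g) and loses all edges of supp(h).
\<close>

lemma sum_on_touched_vertices:
  assumes y: "\<And>e. \<lbrakk>e \<in> E; g e = 0; h e = 0\<rbrakk> \<Longrightarrow> y e = 0"
  shows "(\<Sum>e\<in>induced_edges E (U \<inter> \<Union>(vec_supp E g)). y e)
         = (\<Sum>e\<in>induced_edges E U. if g e \<noteq> 0 then y e else (0::real))"
proof (rule sum.mono_neutral_cong_left)
  show "finite (induced_edges E U)"
    by (rule finite_induced_edges[OF graph])
  show "induced_edges E (U \<inter> \<Union>(vec_supp E g)) \<subseteq> induced_edges E U"
    by (auto simp: induced_edges_def)
  show "\<forall>e\<in>induced_edges E U - induced_edges E (U \<inter> \<Union>(vec_supp E g)).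
          (if g e \<noteq> 0 then y e else 0) = 0"
    by (auto simp: induced_edges_def vec_supp_def)
next
  fix e
  assume "e \<in> induced_edges E (U \<inter> \<Union>(vec_supp E g))"
  then have e: "e \<in> E" and touched: "e \<subseteq> \<Union>(vec_supp E g)"
    by (auto simp: induced_edges_def)
  obtain e' where "e' \<in> E" "g e' \<noteq> 0" "e' \<inter> e \<noteq> {}"
    using edge[OF e] touched by (fastforce simp: vec_supp_def)
  then have "h e = 0"
    using disjoint e by blast
  then show "y e = (if g e \<noteq> 0 then y e else 0)"
    using y e by auto
qed

lemma proportional_if_circuit:
  assumes "rank_circuit V E g"
  shows "\<exists>c. \<forall>e\<in>E. g e \<noteq> 0 \<longrightarrow> x e = c * g e"
proof -
  define y where "y = (\<lambda>e. if g e \<noteq> 0 then x e else 0)"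
  have "(\<Sum>e\<in>induced_edges E U. y e) = 0"
    if U: "U \<subseteq> V" and 0: "(\<Sum>e\<in>induced_edges E U. g e) = 0" for U
  proof -
    let ?W = "U \<inter> \<Union>(vec_supp E g)"
    have "(\<Sum>e\<in>induced_edges E ?W. g e + h e)
            = (\<Sum>e\<in>induced_edges E U. if g e \<noteq> 0 then g e + h e else 0)"
      by (rule sum_on_touched_vertices) simp
    also have "\<dots> = (\<Sum>e\<in>induced_edges E U. g e)"
      by (intro sum.cong) (auto simp: h_zero induced_edges_def)
    finally have "(\<Sum>e\<in>induced_edges E ?W. x e) = 0"
      using U 0 by (intro dominated) auto
    then show ?thesis
      unfolding y_def by (subst (asm) sum_on_touched_vertices) (auto simp: x_zero)
  qed
  then obtain c where "\<forall>e\<in>E. y e = c * g e"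
    using rank_circuit_dominates_only_multiples[OF graph assms] by blast
  then show ?thesis
    unfolding y_def by metis
qed

text \<open>
  Every edge of supp(g) inside the union of e and f avoids f and hence equals e; likewise for
  supp(h). So z and x see only e and f there.
\<close>

lemma opposite_entries_cancel:
  assumes e: "e \<in> E" "g e \<noteq> 0" and f: "f \<in> E" "h f \<noteq> 0" and opp: "g e + h f = 0"
  shows "x e + x f = 0"
proof -
  have ne: "e \<noteq> f"
    using e f h_zero by blast
  have only: "a = e \<or> a = f" if a: "a \<in> E" "a \<subseteq> e \<union> f" "g a \<noteq> 0 \<or> h a \<noteq> 0" for a
  proof (cases "g a = 0")
    case False
    then have "a \<subseteq> e" using a f disjoint[of a f] by blast
    then have "a \<in> induced_edges E e" using a by (simp add: induced_edges_def)
    then show ?thesis using e by (simp add: induced_edges_edge[OF graph])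
  next
    case True
    then have "a \<subseteq> f" using a e disjoint[of e a] by blast
    then have "a \<in> induced_edges E f" using a by (simp add: induced_edges_def)
    then show ?thesis using f by (simp add: induced_edges_edge[OF graph])
  qed
  have two: "(\<Sum>a\<in>induced_edges E (e \<union> f). y a) = y e + y f"
    if y: "\<And>a. \<lbrakk>a \<in> E; g a = 0; h a = 0\<rbrakk> \<Longrightarrow> y a = 0" for y :: "'a set \<Rightarrow> real"
  proof -
    have "(\<Sum>a\<in>induced_edges E (e \<union> f). y a) = (\<Sum>a\<in>{e, f}. y a)"
    proof (rule sum.mono_neutral_right)
      show "finite (induced_edges E (e \<union> f))"
        by (rule finite_induced_edges[OF graph])
      show "{e, f} \<subseteq> induced_edges E (e \<union> f)"
        using e f by (auto simp: induced_edges_def)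
      show "\<forall>a\<in>induced_edges E (e \<union> f) - {e, f}. y a = 0"
        using only y by (auto simp: induced_edges_def)
    qed
    then show ?thesis using ne by simp
  qed
  have "h e = 0" "g f = 0"
    using e f h_zero by auto
  then have "(\<Sum>a\<in>induced_edges E (e \<union> f). g a + h a) = 0"
    using opp by (subst two) auto
  then have "(\<Sum>a\<in>induced_edges E (e \<union> f). x a) = 0"
    using e f edge by (intro dominated) auto
  then show ?thesis
    by (subst (asm) two) (auto simp: x_zero)
qed

lemma proportional_if_opposed:
  assumes f: "f \<in> E" "h f \<noteq> 0" and opp: "\<forall>e\<in>E. g e \<noteq> 0 \<longrightarrow> g e + h f = 0"
  shows "\<exists>c. \<forall>e\<in>E. g e \<noteq> 0 \<longrightarrow> x e = c * g e"
proof -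
  have "x e = (x f / h f) * g e" if e: "e \<in> E" "g e \<noteq> 0" for e
  proof -
    have "x e = - x f" "g e = - h f"
      using opposite_entries_cancel[OF e f] opp e by fastforce+
    then show ?thesis using f by simp
  qed
  then show ?thesis by blast
qed

lemma proportional_to_sum:
  assumes g: "\<exists>c. \<forall>e\<in>E. g e \<noteq> 0 \<longrightarrow> x e = c * g e"
    and h: "\<exists>c. \<forall>e\<in>E. h e \<noteq> 0 \<longrightarrow> x e = c * h e"
    and opp: "\<exists>e\<in>E. \<exists>f\<in>E. g e \<noteq> 0 \<and> h f \<noteq> 0 \<and> g e + h f = 0"
  shows "\<exists>c. \<forall>e\<in>E. x e = c * (g e + h e)"
proof -
  obtain c where c: "\<forall>e\<in>E. g e \<noteq> 0 \<longrightarrow> x e = c * g e" using g by blast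
  obtain d where d: "\<forall>e\<in>E. h e \<noteq> 0 \<longrightarrow> x e = d * h e" using h by blast
  obtain e f where ef: "e \<in> E" "g e \<noteq> 0" "f \<in> E" "h f \<noteq> 0" "g e + h f = 0"
    using opp by blast
  have "c * g e + d * h f = 0"
    using opposite_entries_cancel[OF ef] c d ef by simp
  moreover have "h f = - g e"
    using ef by simp
  ultimately have "d = c"
    using ef by simp
  have "x a = c * (g a + h a)" if "a \<in> E" for a
    using that c d \<open>d = c\<close> h_zero[of a] x_zero[of a]
    by (cases "g a = 0"; cases "h a = 0") auto
  then show ?thesis by blast
qed

end

section \<open>Signs of the two summands\<close>

definition opposed_entry :: "'i set \<Rightarrow> ('i \<Rightarrow> real) \<Rightarrow> ('i \<Rightarrow> real) \<Rightarrow> bool" where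
  "opposed_entry I x y \<longleftrightarrow> (\<exists>j\<in>I. y j \<noteq> 0 \<and> (\<forall>i\<in>I. x i \<noteq> 0 \<longrightarrow> x i + y j = 0))"

lemma opposed_entry_if_mixed:
  assumes x: "\<forall>i\<in>I. x i \<in> {0, 1, -1}" and y: "\<forall>i\<in>I. y i \<in> {0, 1, -1}"
    and "uniform_sign I x" and mixed: "mixed_sign I y"
  shows "opposed_entry I x y"
proof -
  obtain p n where p: "p \<in> I" "y p = 1" and n: "n \<in> I" "y n = -1"
    using mixed y unfolding mixed_sign_def by fastforce
  have "(\<forall>i\<in>I. x i \<le> 0) \<or> (\<forall>i\<in>I. x i \<ge> 0)"
    using assms(3) unfolding uniform_sign_def mixed_sign_def by (meson not_less)
  then show ?thesis
  proof
    assume "\<forall>i\<in>I. x i \<le> 0"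
    then have "\<forall>i\<in>I. x i \<noteq> 0 \<longrightarrow> x i + y p = 0"
      using x p by fastforce
    then show ?thesis
      using p unfolding opposed_entry_def by (intro bexI[of _ p]) auto
  next
    assume "\<forall>i\<in>I. x i \<ge> 0"
    then have "\<forall>i\<in>I. x i \<noteq> 0 \<longrightarrow> x i + y n = 0"
      using x n by fastforce
    then show ?thesis
      using n unfolding opposed_entry_def by (intro bexI[of _ n]) auto
  qed
qed

lemma opposed_entry_if_opposite_sign:
  assumes x: "\<forall>i\<in>I. x i \<in> {0, 1, -1}" and y: "\<forall>i\<in>I. y i \<in> {0, 1, -1}"
    and "nonzero_vec I y" and opp: "opposite_sign I x y"
  shows "opposed_entry I x y"
proof -
  obtain j where j: "j \<in> I" "y j \<noteq> 0"
    using assms(3) by (auto simp: nonzero_vec_def)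
  have "x i + y j = 0" if i: "i \<in> I" "x i \<noteq> 0" for i
  proof -
    have "x i = 1 \<or> x i = -1" "y j = 1 \<or> y j = -1"
      using i j x y by auto
    moreover have "x i \<ge> 0 \<and> y j \<le> 0 \<or> x i \<le> 0 \<and> y j \<ge> 0"
      using opp i j unfolding opposite_sign_def by auto
    ultimately show ?thesis by auto
  qed
  then show ?thesis
    using j unfolding opposed_entry_def by blast
qed

theorem lemma4p4:
  fixes V :: "'a set" and E :: "'a set set" and g h :: "'a set \<Rightarrow> real"
  assumes "finite_simple_graph V E"
    and "\<forall>e\<in>E. g e \<in> {0, 1, -1}"
    and "\<forall>e\<in>E. h e \<in> {0, 1, -1}"
    and "nonzero_vec E g"
    and "nonzero_vec E h"
    and "\<not> (\<exists>v\<in>V. (\<exists>e\<in>vec_supp E g. v \<in> e) \<and> (\<exists>f\<in>vec_supp E h. v \<in> f))"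
    and "(uniform_sign E g \<and>
            ((mixed_sign E h \<and> rank_circuit V E h) \<or>
             (uniform_sign E h \<and> opposite_sign E g h)))
         \<or> ((mixed_sign E g \<and> rank_circuit V E g) \<and> (mixed_sign E h \<and> rank_circuit V E h))"
  shows "rank_circuit V E (\<lambda>e. g e + h e)"
proof -
  note graph = assms(1) and g = assms(2) and h = assms(3)
  have disj: "e \<inter> f = {}" if "e \<in> E" "f \<in> E" "g e \<noteq> 0" "h f \<noteq> 0" for e f
    using assms(6) graph that unfolding vec_supp_def finite_simple_graph_def by blast
  have no_overlap: "g e = 0 \<or> h e = 0" if "e \<in> E" for e
    using disj[of e e] that graph by (fastforce simp: finite_simple_graph_def)
  have val: "\<forall>e\<in>E. g e + h e \<in> {0, 1, -1}"
    using g h no_overlap by force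
  have nz: "nonzero_vec E (\<lambda>e. g e + h e)"
    using assms(4) no_overlap unfolding nonzero_vec_def by force

  have g_part: "rank_circuit V E g \<or> opposed_entry E g h"
    using assms(7) opposed_entry_if_mixed[OF g h] opposed_entry_if_opposite_sign[OF g h assms(5)]
    by blast
  have h_part: "rank_circuit V E h \<or> opposed_entry E h g"
    using assms(7) opposed_entry_if_opposite_sign[OF h g assms(4)]
    by (auto simp: opposite_sign_def)
  have opp: "\<exists>e\<in>E. \<exists>f\<in>E. g e \<noteq> 0 \<and> h f \<noteq> 0 \<and> g e + h f = 0"
  proof (cases "uniform_sign E g")
    case True
    then have "opposed_entry E g h"
      using assms(7) opposed_entry_if_mixed[OF g h] opposed_entry_if_opposite_sign[OF g h assms(5)]
      by (auto simp: uniform_sign_def)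
    then show ?thesis
      using assms(4) unfolding opposed_entry_def nonzero_vec_def by blast
  next
    case False
    then have "mixed_sign E g" "mixed_sign E h"
      using assms(7) by auto
    then obtain e f where ef: "e \<in> E" "g e > 0" "f \<in> E" "h f < 0"
      unfolding mixed_sign_def by blast
    then have "g e = 1" "h f = -1"
      using g h by fastforce+
    then show ?thesis
      using ef by (intro bexI[of _ e] bexI[of _ f]) auto
  qed

  show ?thesis
    unfolding rank_circuit_def
  proof (rule system_circuitI[OF nz coprime_integer_vec_if_sign_entries[OF val nz]])
    fix x
    assume "vec_supp (rank_rows V) (mat_vec E (rank_matrix E) x)
              \<subseteq> vec_supp (rank_rows V) (mat_vec E (rank_matrix E) (\<lambda>e. g e + h e))"
    then interpret gh: dominated_by_disjoint_sum V E g h x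
      using graph disj by unfold_locales (auto simp: rank_supp_subset_iff[OF graph])
    interpret hg: dominated_by_disjoint_sum V E h g x
      by (rule gh.swapped)
    show "\<exists>c. \<forall>e\<in>E. x e = c * (g e + h e)"
      using g_part h_part opp gh.proportional_if_circuit gh.proportional_if_opposed
        hg.proportional_if_circuit hg.proportional_if_opposed
      unfolding opposed_entry_def by (intro gh.proportional_to_sum) blast+
  qed
qed

end
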